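(* Let $\mu$ be a Borel probability measure on $\mathbb{R}^d$. For fixed positive constants $A$ and $B$, let $\mathcal{B}_B(\mu)$ denote the set of all Bessel measures for $\mu$ with bound $B$ and let $\mathcal{F}_{A,B}(\mu)$ denote the set of all frame measures for $\mu$ with bounds $A,B$. Both sets, while possibly empty, are convex and closed under convolution with Borel probability measures on $\mathbb{R}^d$.
   Context: For $f\in L^1(\mu)$, put $\widehat{f\,d\mu}(t)=\int f(x)e^{-2\pi i t\cdot x}\,d\mu(x)$, $t\in\mathbb{R}^d$. A (nonnegative) Borel measure $\nu$ on $\mathbb{R}^d$ is a Bessel measure for $\mu$ with bound $B>0$ if $\|\widehat{f\,d\mu}\|_{L^2(\nu)}^2\le B\|f\|_{L^2(\mu)}^2$ for every $f\in L^2(\mu)$. It is a frame measure for $\mu$ with bounds $A,B>0$ if $A\|f\|_{L^2(\mu)}^2\le \|\widehat{f\,d\mu}\|_{L^2(\nu)}^2\le B\|f\|_{L^2(\mu)}^2$ for every $f\in L^2(\mu)$. *)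

theory Defs
  imports "HOL-Probability.Probability"
begin

definition borel_measure :: "(real ^ 'n) measure \<Rightarrow> bool" where
  "borel_measure \<nu> \<longleftrightarrow> sets \<nu> = sets borel"

definition square_integrable :: "'a measure \<Rightarrow> ('a \<Rightarrow> complex) \<Rightarrow> bool" where
  "square_integrable M f \<longleftrightarrow> f \<in> borel_measurable M \<and> integrable M (\<lambda>x. (norm (f x))\<^sup>2)"

text \<open>The squared norm is extended-real valued: the transform of an \<open>L\<^sup>2(\<mu>)\<close> function is not
  known in advance to lie in \<open>L\<^sup>2(\<nu>)\<close>.\<close>

definition L2_norm_sq :: "'a measure \<Rightarrow> ('a \<Rightarrow> complex) \<Rightarrow> ennreal" where
  "L2_norm_sq M f = (\<integral>\<^sup>+ x. ennreal ((norm (f x))\<^sup>2) \<partial>M)"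

definition fourier_transform ::
    "(real ^ 'n) measure \<Rightarrow> (real ^ 'n \<Rightarrow> complex) \<Rightarrow> real ^ 'n \<Rightarrow> complex" where
  "fourier_transform \<mu> f t = (LINT x|\<mu>. f x * exp (- 2 * of_real pi * \<i> * of_real (t \<bullet> x)))"

definition bessel_measures :: "real \<Rightarrow> (real ^ 'n) measure \<Rightarrow> (real ^ 'n) measure set" where
  "bessel_measures B \<mu> = {\<nu>. borel_measure \<nu> \<and>
     (\<forall>f. square_integrable \<mu> f \<longrightarrow>
        L2_norm_sq \<nu> (fourier_transform \<mu> f) \<le> ennreal B * L2_norm_sq \<mu> f)}"

definition frame_measures ::
    "real \<Rightarrow> real \<Rightarrow> (real ^ 'n) measure \<Rightarrow> (real ^ 'n) measure set" where
  "frame_measures A B \<mu> = {\<nu>. borel_measure \<nu> \<and>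
     (\<forall>f. square_integrable \<mu> f \<longrightarrow>
        ennreal A * L2_norm_sq \<mu> f \<le> L2_norm_sq \<nu> (fourier_transform \<mu> f) \<and>
        L2_norm_sq \<nu> (fourier_transform \<mu> f) \<le> ennreal B * L2_norm_sq \<mu> f)}"

text \<open>Measures do not form a real vector space, so the library's \<^const>\<open>convex\<close> does not apply.\<close>

definition add_measure :: "'a measure \<Rightarrow> 'a measure \<Rightarrow> 'a measure" where
  "add_measure M N = measure_of (space M) (sets M) (\<lambda>X. emeasure M X + emeasure N X)"

lemma space_add_measure [simp]: "space (add_measure M N) = space M"
  and sets_add_measure [simp, measurable_cong]: "sets (add_measure M N) = sets M"
  by (simp_all add: add_measure_def)

lemma emeasure_add_measure:
  assumes "sets N = sets M"
  shows "emeasure (add_measure M N) X = emeasure M X + emeasure N X"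
proof (cases "X \<in> sets M")
  case True
  have "countably_additive (sets M) (\<lambda>X. emeasure M X + emeasure N X)"
  proof (rule countably_additiveI)
    fix F :: "nat \<Rightarrow> 'a set"
    assume F: "range F \<subseteq> sets M" "disjoint_family F"
    then show "(\<Sum>i. emeasure M (F i) + emeasure N (F i)) =
        emeasure M (\<Union>i. F i) + emeasure N (\<Union>i. F i)"
      using suminf_emeasure[of F M] suminf_emeasure[of F N] assms
      by (simp add: suminf_add[symmetric])
  qed
  then show ?thesis
    unfolding add_measure_def using True
    by (intro emeasure_measure_of_sigma) (auto simp: positive_def sets.sigma_algebra_axioms)
next
  case False
  then show ?thesis
    using assms by (simp add: emeasure_notin_sets)
qed

definition convex_measures :: "'a measure set \<Rightarrow> bool" where
  "convex_measures S \<longleftrightarrow> (\<forall>\<nu>\<^sub>1\<in>S. \<forall>\<nu>\<^sub>2\<in>S. \<forall>s\<in>{0..1::real}.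
     add_measure (scale_measure (ennreal s) \<nu>\<^sub>1) (scale_measure (ennreal (1 - s)) \<nu>\<^sub>2) \<in> S)"

text \<open>\<open>\<nu>\<close> may be infinite here. The product measure behind \<open>\<star>\<close> is the usual one when \<open>\<nu>\<close> is
  sigma-finite; Bessel and frame measures of a Borel probability measure are, because the upper
  bound makes them locally finite.\<close>

definition closed_under_prob_convolution :: "(real ^ 'n) measure set \<Rightarrow> bool" where
  "closed_under_prob_convolution S \<longleftrightarrow>
     (\<forall>\<nu>\<in>S. \<forall>\<rho>. borel_measure \<rho> \<and> prob_space \<rho> \<longrightarrow> (\<nu> \<star> \<rho>) \<in> S)"

end

theory Submission
  imports Defs
begin

text \<open>
  The conditions defining Bessel and frame measures bound \<open>\<integral> \<bar>F\<bar>\<^sup>2 \<partial>\<nu>\<close>, where \<open>F\<close> is the transform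
  of a function \<open>f\<close>, by multiples of \<open>\<parallel>f\<parallel>\<^sup>2\<close>. This integral is linear in \<open>\<nu>\<close>, and
  a convex combination of numbers in \<open>[A\<parallel>f\<parallel>\<^sup>2, B\<parallel>f\<parallel>\<^sup>2]\<close> stays in that interval; this gives
  convexity (\<open>L2_norm_sq_convex_combination\<close>).

  Convolving with a probability measure \<open>\<rho>\<close> averages the translates of \<open>\<nu>\<close> over \<open>\<rho>\<close>. A translate
  of \<open>\<nu>\<close> is as good as \<open>\<nu>\<close> itself: translating the transform by \<open>y\<close> amounts to multiplying \<open>f\<close> by
  the character \<open>x \<mapsto> exp (- 2\<pi>i y \<bullet> x)\<close>, which does not change \<open>\<parallel>f\<parallel>\<close>. Hence the integral against
  the convolution is a \<open>\<rho>\<close>-average of numbers that all satisfy the same bounds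
  (\<open>L2_norm_sq_convolution\<close>).

  Writing the convolution as an average over \<open>\<rho>\<close> interchanges two integrals, so \<open>\<nu>\<close> has to be
  sigma-finite (\<open>bessel_measure_sigma_finite\<close>). The transform of the constant \<open>1\<close> is continuous
  with value \<open>1\<close> at the origin, so its modulus exceeds \<open>1/2\<close> on an open neighbourhood of the
  origin, and the Bessel bound for the characters makes \<open>\<nu>\<close> finite on every translate of
  this neighbourhood.
\<close>

section \<open>Integrals over convex combinations of measures\<close>

lemma nn_integral_add_measure:
  assumes N: "sets N = sets M" and f: "f \<in> borel_measurable M"
  shows "(\<integral>\<^sup>+ x. f x \<partial>add_measure M N) = (\<integral>\<^sup>+ x. f x \<partial>M) + (\<integral>\<^sup>+ x. f x \<partial>N)"
  using f
proof (induction rule: borel_measurable_induct)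
  case (cong f g)
  have "space N = space M"
    using N by (rule sets_eq_imp_space_eq)
  with cong(3) have "(\<integral>\<^sup>+ x. f x \<partial>K) = (\<integral>\<^sup>+ x. g x \<partial>K)"
    if "K \<in> {M, N, add_measure M N}" for K
    using that by (intro nn_integral_cong) auto
  with cong(4) show ?case
    by simp
next
  case (set A)
  then show ?case
    using N by (simp add: emeasure_add_measure)
next
  case (mult u c)
  then have "u \<in> borel_measurable N" "u \<in> borel_measurable (add_measure M N)"
    using N by (simp_all cong: measurable_cong_sets)
  with mult show ?case
    by (simp add: nn_integral_cmult distrib_left)
next
  case (add u v)
  then have "u \<in> borel_measurable N" "u \<in> borel_measurable (add_measure M N)"
      "v \<in> borel_measurable N" "v \<in> borel_measurable (add_measure M N)"
    using N by (simp_all cong: measurable_cong_sets)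
  with add show ?case
    by (simp add: nn_integral_add ac_simps)
next
  case (seq U)
  have meas: "U i \<in> borel_measurable N" "U i \<in> borel_measurable (add_measure M N)" for i
    using seq(1)[of i] N by (simp_all cong: measurable_cong_sets)
  have inc: "incseq (\<lambda>i. \<integral>\<^sup>+ x. U i x \<partial>K)" for K
    using seq by (auto simp: incseq_def le_fun_def intro!: nn_integral_mono)
  have "(SUP i. (\<integral>\<^sup>+ x. U i x \<partial>M) + (\<integral>\<^sup>+ x. U i x \<partial>N)) =
      (SUP i. \<integral>\<^sup>+ x. U i x \<partial>M) + (SUP i. \<integral>\<^sup>+ x. U i x \<partial>N)"
    by (intro ennreal_SUP_add inc)
  with seq meas show ?case
    by (simp add: nn_integral_monotone_convergence_SUP image_comp)
qed

lemma L2_norm_sq_convex_combination: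
  assumes "sets \<nu>\<^sub>1 = sets borel" "sets \<nu>\<^sub>2 = sets borel" and "F \<in> borel_measurable borel"
  shows "L2_norm_sq (add_measure (scale_measure a \<nu>\<^sub>1) (scale_measure b \<nu>\<^sub>2)) F =
    a * L2_norm_sq \<nu>\<^sub>1 F + b * L2_norm_sq \<nu>\<^sub>2 F"
proof -
  have "(\<lambda>x. ennreal ((norm (F x))\<^sup>2)) \<in> borel_measurable borel"
    using assms by measurable
  then show ?thesis
    using assms unfolding L2_norm_sq_def
    by (simp add: nn_integral_add_measure nn_integral_scale_measure cong: measurable_cong_sets)
qed

lemma ennreal_convex_combination_const:
  assumes "s \<in> {0..1::real}"
  shows "ennreal s * c + ennreal (1 - s) * c = c"
proof -
  have "ennreal s * c + ennreal (1 - s) * c = ennreal (s + (1 - s)) * c"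
    using assms by (subst ennreal_plus) (auto simp: distrib_right)
  then show ?thesis by simp
qed

section \<open>Translates of transforms\<close>

definition modulate :: "real ^ 'n \<Rightarrow> (real ^ 'n \<Rightarrow> complex) \<Rightarrow> real ^ 'n \<Rightarrow> complex" where
  "modulate y f x = f x * exp (- 2 * of_real pi * \<i> * of_real (y \<bullet> x))"

lemma norm_modulate [simp]: "norm (modulate y f x) = norm (f x)"
  by (simp add: modulate_def norm_mult)

lemma L2_norm_sq_modulate [simp]: "L2_norm_sq \<mu> (modulate y f) = L2_norm_sq \<mu> f"
  by (simp add: L2_norm_sq_def)

lemma square_integrable_modulate:
  assumes \<mu>: "borel_measure \<mu>" and f: "square_integrable \<mu> f"
  shows "square_integrable \<mu> (modulate y f)"
proof -
  have [measurable_cong]: "sets \<mu> = sets borel"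
    using \<mu> by (simp add: borel_measure_def)
  have [measurable]: "f \<in> borel_measurable \<mu>"
    using f by (simp add: square_integrable_def)
  have "modulate y f \<in> borel_measurable \<mu>"
    unfolding modulate_def by measurable
  with f show ?thesis
    by (simp add: square_integrable_def)
qed

text \<open>This is what makes both classes of measures invariant under translation: the factor that
  shifts the transform has modulus one, so it is invisible to the norm of \<open>f\<close>.\<close>

lemma fourier_transform_modulate:
  "fourier_transform \<mu> (modulate y f) t = fourier_transform \<mu> f (t + y)"
  unfolding fourier_transform_def modulate_def
  by (intro Bochner_Integration.integral_cong refl)
    (simp add: inner_add_left mult.assoc exp_add[symmetric] algebra_simps)

lemma fourier_transform_measurable:
  assumes \<mu>: "borel_measure \<mu>" and "sigma_finite_measure \<mu>" and [measurable]: "f \<in> borel_measurable \<mu>"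
  shows "fourier_transform \<mu> f \<in> borel_measurable borel"
proof -
  interpret sigma_finite_measure \<mu> by fact
  have [measurable_cong]: "sets \<mu> = sets borel"
    using \<mu> by (simp add: borel_measure_def)
  show ?thesis
    unfolding fourier_transform_def by measurable
qed

section \<open>Sigma-finiteness of Bessel measures\<close>

lemma continuous_fourier_transform:
  assumes \<mu>: "borel_measure \<mu>" and f: "integrable \<mu> f"
  shows "continuous_on UNIV (fourier_transform \<mu> f)"
proof -
  have [measurable_cong]: "sets \<mu> = sets borel"
    using \<mu> by (simp add: borel_measure_def)
  have [measurable]: "f \<in> borel_measurable \<mu>"
    using f by simp
  have "isCont (fourier_transform \<mu> f) t" for t
    unfolding continuous_at_sequentially comp_def fourier_transform_def
  proof (intro allI impI)
    fix u assume u: "u \<longlonglongrightarrow> t"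
    show "(\<lambda>n. LINT x|\<mu>. f x * exp (- 2 * of_real pi * \<i> * of_real (u n \<bullet> x))) \<longlonglongrightarrow>
        (LINT x|\<mu>. f x * exp (- 2 * of_real pi * \<i> * of_real (t \<bullet> x)))"
    proof (rule integral_dominated_convergence[where w = "\<lambda>x. norm (f x)"])
      show "AE x in \<mu>. (\<lambda>n. f x * exp (- 2 * of_real pi * \<i> * of_real (u n \<bullet> x))) \<longlonglongrightarrow>
          f x * exp (- 2 * of_real pi * \<i> * of_real (t \<bullet> x))"
        by (intro AE_I2 tendsto_intros u)
    qed (use f in \<open>auto simp: norm_mult\<close>)
  qed
  then show ?thesis
    by (simp add: continuous_on_eq_continuous_at)
qed

text \<open>The Bessel inequality is tested on the characters only: each has norm one, and its transform
  is a translate of the transform of \<open>1\<close>, which is bounded away from zero near the origin.\<close>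

lemma bessel_measure_sigma_finite:
  assumes \<mu>: "borel_measure \<mu>" "prob_space \<mu>" and \<nu>: "\<nu> \<in> bessel_measures B \<mu>"
  shows "sigma_finite_measure \<nu>"
proof -
  interpret \<mu>: prob_space \<mu> by fact
  have sets_\<nu> [measurable_cong]: "sets \<nu> = sets borel"
    using \<nu> by (simp add: bessel_measures_def borel_measure_def)
  have space_\<nu>: "space \<nu> = UNIV"
    using sets_eq_imp_space_eq[OF sets_\<nu>] by simp
  let ?one = "\<lambda>_::real^'n. 1::complex"
  \<comment> \<open>Modulating by \<open>- a\<close> moves the transform of \<open>1\<close> to the centre \<open>a\<close>, so the sets \<open>V a\<close> are
    translates of one neighbourhood of the origin; any threshold below \<open>1\<close> would do.\<close>
  define V where "V a = {t. 1 / 2 < norm (fourier_transform \<mu> (modulate (- a) ?one) t)}" for a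
  have V_open: "open (V a)" for a
  proof -
    have "continuous_on UNIV (fourier_transform \<mu> ?one)"
      using \<mu> by (intro continuous_fourier_transform) auto
    then have "continuous_on UNIV (\<lambda>t. fourier_transform \<mu> ?one (t + - a))"
      by (rule continuous_on_compose2) (intro continuous_on_add continuous_on_id continuous_on_const subset_UNIV)+
    then have "continuous_on UNIV (\<lambda>t. norm (fourier_transform \<mu> ?one (t + - a)))"
      by (rule continuous_on_norm)
    then show ?thesis
      unfolding V_def fourier_transform_modulate by (intro open_Collect_less continuous_on_const)
  qed
  have V_centre: "a \<in> V a" for a
    unfolding V_def fourier_transform_modulate
    by (simp add: fourier_transform_def \<mu>.prob_space)
  have V_finite: "emeasure \<nu> (V a) \<noteq> \<infinity>" for a
  proof -
    let ?F = "fourier_transform \<mu> (modulate (- a) ?one)"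
    have sq: "square_integrable \<mu> (modulate (- a) ?one)"
      using \<mu> by (intro square_integrable_modulate) (auto simp: square_integrable_def)
    then have [measurable]: "?F \<in> borel_measurable borel"
      using \<mu> \<mu>.sigma_finite_measure_axioms
      by (intro fourier_transform_measurable) (auto simp: square_integrable_def)
    \<comment> \<open>Chebyshev's inequality; \<open>4\<close> is the inverse square of the threshold \<open>1/2\<close>.\<close>
    have "emeasure \<nu> (V a) \<le> emeasure \<nu> {t \<in> space \<nu>. 1 \<le> 4 * ennreal ((norm (?F t))\<^sup>2)}"
    proof (rule emeasure_mono)
      show "V a \<subseteq> {t \<in> space \<nu>. 1 \<le> 4 * ennreal ((norm (?F t))\<^sup>2)}"
      proof
        fix t assume "t \<in> V a"
        then have "(1 / 2)\<^sup>2 \<le> (norm (?F t))\<^sup>2"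
          unfolding V_def by (intro power_mono) auto
        then have "ennreal 1 \<le> ennreal (4 * (norm (?F t))\<^sup>2)"
          by (intro ennreal_leI) (simp add: power2_eq_square)
        then show "t \<in> {t \<in> space \<nu>. 1 \<le> 4 * ennreal ((norm (?F t))\<^sup>2)}"
          by (simp add: space_\<nu> ennreal_mult)
      qed
    qed measurable
    also have "\<dots> \<le> 4 * (\<integral>\<^sup>+ t. ennreal ((norm (?F t))\<^sup>2) * indicator (space \<nu>) t \<partial>\<nu>)"
      by (intro nn_integral_Markov_inequality) measurable
    also have "\<dots> = 4 * L2_norm_sq \<nu> ?F"
      by (simp add: L2_norm_sq_def cong: nn_integral_cong)
    also have "\<dots> \<le> 4 * (ennreal B * L2_norm_sq \<mu> (modulate (- a) ?one))"
      using \<nu> sq by (intro mult_left_mono) (auto simp: bessel_measures_def)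
    also have "\<dots> = 4 * ennreal B"
      by (simp add: L2_norm_sq_def \<mu>.emeasure_space_1)
    also have "\<dots> < \<infinity>"
      by (simp add: ennreal_mult_less_top)
    finally show ?thesis by simp
  qed
  \<comment> \<open>Countably many of the \<open>V a\<close> suffice, although the centres range over the whole space.\<close>
  obtain \<V> where \<V>: "\<V> \<subseteq> range V" "countable \<V>" "\<Union>\<V> = \<Union>(range V)"
    using Lindelof[of "range V"] V_open by (metis imageE)
  show ?thesis
  proof
    show "\<exists>A. countable A \<and> A \<subseteq> sets \<nu> \<and> \<Union>A = space \<nu> \<and> (\<forall>a\<in>A. emeasure \<nu> a \<noteq> \<infinity>)"
      using \<V> V_open V_centre V_finite by (intro exI[of _ \<V>]) (auto simp: sets_\<nu> space_\<nu>)
  qed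
qed

section \<open>Transforms and convolution\<close>

text \<open>Finiteness would be too much to ask of both factors: Lebesgue measure is a Bessel measure (with
  a suitable bound) whenever \<open>\<mu>\<close> has a bounded density. The translation parameter is the variable
  of the outer integral, so that the inner one is the norm of a translated transform.\<close>

lemma nn_integral_convolution_sigma_finite:
  assumes "sigma_finite_measure M" "sigma_finite_measure N"
    and [measurable_cong]: "sets M = sets borel" "sets N = sets borel"
    and [measurable]: "f \<in> borel_measurable borel"
  shows "(\<integral>\<^sup>+ x. f x \<partial>(M \<star> N)) = (\<integral>\<^sup>+ y. \<integral>\<^sup>+ x. f (x + y) \<partial>M \<partial>N)"
proof -
  interpret M: sigma_finite_measure M by fact
  interpret N: sigma_finite_measure N by fact
  interpret pair_sigma_finite M N ..
  show ?thesis
    unfolding convolution_def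
    by (simp add: nn_integral_distr nn_integral_snd[symmetric])
qed

text \<open>The inner integral runs over the transform translated by \<open>y\<close>, which is the transform of
  \<open>modulate y f\<close>. Any bound by a multiple of \<open>\<parallel>f\<parallel>\<^sup>2\<close> therefore holds for each \<open>y\<close> separately, and
  averaging over a probability measure \<open>\<rho>\<close> keeps it.\<close>

lemma L2_norm_sq_convolution:
  assumes \<mu>: "borel_measure \<mu>" "sigma_finite_measure \<mu>" and f: "f \<in> borel_measurable \<mu>"
    and \<nu>: "borel_measure \<nu>" "sigma_finite_measure \<nu>"
    and \<rho>: "borel_measure \<rho>" "sigma_finite_measure \<rho>"
  shows "L2_norm_sq (\<nu> \<star> \<rho>) (fourier_transform \<mu> f) =
    (\<integral>\<^sup>+ y. L2_norm_sq \<nu> (fourier_transform \<mu> (modulate y f)) \<partial>\<rho>)"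
proof -
  have [measurable]: "fourier_transform \<mu> f \<in> borel_measurable borel"
    using \<mu> f by (rule fourier_transform_measurable)
  show ?thesis
    using \<nu> \<rho> unfolding L2_norm_sq_def fourier_transform_modulate borel_measure_def
    by (intro nn_integral_convolution_sigma_finite) auto
qed

section \<open>Convexity and convolution\<close>

lemma frame_measures_iff_lower_bound:
  "\<nu> \<in> frame_measures A B \<mu> \<longleftrightarrow> \<nu> \<in> bessel_measures B \<mu> \<and>
    (\<forall>f. square_integrable \<mu> f \<longrightarrow>
      ennreal A * L2_norm_sq \<mu> f \<le> L2_norm_sq \<nu> (fourier_transform \<mu> f))"
  by (auto simp: frame_measures_def bessel_measures_def)

text \<open>The bounds \<open>l\<close> and \<open>u\<close> are common to both norms, so that the lower and the upper bound
  survive by the same computation.\<close>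

lemma L2_norm_sq_convex_combination_bounds:
  assumes "sets \<nu>\<^sub>1 = sets borel" "sets \<nu>\<^sub>2 = sets borel" and "F \<in> borel_measurable borel"
    and s: "s \<in> {0..1}"
  shows "l \<le> L2_norm_sq \<nu>\<^sub>1 F \<Longrightarrow> l \<le> L2_norm_sq \<nu>\<^sub>2 F \<Longrightarrow>
      l \<le> L2_norm_sq (add_measure (scale_measure (ennreal s) \<nu>\<^sub>1) (scale_measure (ennreal (1 - s)) \<nu>\<^sub>2)) F"
    and "L2_norm_sq \<nu>\<^sub>1 F \<le> u \<Longrightarrow> L2_norm_sq \<nu>\<^sub>2 F \<le> u \<Longrightarrow>
      L2_norm_sq (add_measure (scale_measure (ennreal s) \<nu>\<^sub>1) (scale_measure (ennreal (1 - s)) \<nu>\<^sub>2)) F \<le> u"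
proof -
  note eq = L2_norm_sq_convex_combination[OF assms(1-3)]
  note const = ennreal_convex_combination_const[OF s]
  show "l \<le> L2_norm_sq (add_measure (scale_measure (ennreal s) \<nu>\<^sub>1) (scale_measure (ennreal (1 - s)) \<nu>\<^sub>2)) F"
    if "l \<le> L2_norm_sq \<nu>\<^sub>1 F" "l \<le> L2_norm_sq \<nu>\<^sub>2 F"
    unfolding eq using that by (subst const[of l, symmetric]) (intro add_mono mult_left_mono; simp)
  show "L2_norm_sq (add_measure (scale_measure (ennreal s) \<nu>\<^sub>1) (scale_measure (ennreal (1 - s)) \<nu>\<^sub>2)) F \<le> u"
    if "L2_norm_sq \<nu>\<^sub>1 F \<le> u" "L2_norm_sq \<nu>\<^sub>2 F \<le> u"
    unfolding eq using that by (subst const[of u, symmetric]) (intro add_mono mult_left_mono; simp)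
qed

lemma
  fixes \<mu> :: "(real ^ 'n) measure"
  assumes \<mu>: "borel_measure \<mu>" "prob_space \<mu>"
  shows convex_bessel_measures: "convex_measures (bessel_measures B \<mu>)"
    and convex_frame_measures: "convex_measures (frame_measures A B \<mu>)"
proof -
  interpret \<mu>: prob_space \<mu> by fact
  have meas: "fourier_transform \<mu> f \<in> borel_measurable borel" if "square_integrable \<mu> f" for f
    using that \<mu> \<mu>.sigma_finite_measure_axioms
    by (intro fourier_transform_measurable) (auto simp: square_integrable_def)
  have bessel: "add_measure (scale_measure (ennreal s) \<nu>\<^sub>1) (scale_measure (ennreal (1 - s)) \<nu>\<^sub>2)
      \<in> bessel_measures B \<mu>"
    if "\<nu>\<^sub>1 \<in> bessel_measures B \<mu>" "\<nu>\<^sub>2 \<in> bessel_measures B \<mu>" "s \<in> {0..1}" for \<nu>\<^sub>1 \<nu>\<^sub>2 s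
    using that by (auto simp: bessel_measures_def borel_measure_def
        intro!: L2_norm_sq_convex_combination_bounds(2) meas)
  then show "convex_measures (bessel_measures B \<mu>)"
    by (simp add: convex_measures_def)
  show "convex_measures (frame_measures A B \<mu>)"
    unfolding convex_measures_def frame_measures_iff_lower_bound
  proof (safe intro!: bessel)
    fix \<nu>\<^sub>1 \<nu>\<^sub>2 s f
    assume \<nu>: "\<nu>\<^sub>1 \<in> frame_measures A B \<mu>" "\<nu>\<^sub>2 \<in> frame_measures A B \<mu>"
      and "s \<in> {0..1::real}" "square_integrable \<mu> f"
    then show "ennreal A * L2_norm_sq \<mu> f \<le> L2_norm_sq
        (add_measure (scale_measure (ennreal s) \<nu>\<^sub>1) (scale_measure (ennreal (1 - s)) \<nu>\<^sub>2))
        (fourier_transform \<mu> f)"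
      by (intro L2_norm_sq_convex_combination_bounds(1) meas)
        (auto simp: frame_measures_def borel_measure_def)
  qed (auto simp: frame_measures_iff_lower_bound)
qed

lemma
  fixes \<mu> :: "(real ^ 'n) measure"
  assumes \<mu>: "borel_measure \<mu>" "prob_space \<mu>"
  shows bessel_measures_closed_under_prob_convolution:
      "closed_under_prob_convolution (bessel_measures B \<mu>)"
    and frame_measures_closed_under_prob_convolution:
      "closed_under_prob_convolution (frame_measures A B \<mu>)"
proof -
  interpret \<mu>: prob_space \<mu> by fact
  have average: "L2_norm_sq (\<nu> \<star> \<rho>) (fourier_transform \<mu> f) =
      (\<integral>\<^sup>+ y. L2_norm_sq \<nu> (fourier_transform \<mu> (modulate y f)) \<partial>\<rho>)"
    if \<nu>: "\<nu> \<in> bessel_measures B \<mu>" and \<rho>: "borel_measure \<rho>" "prob_space \<rho>"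
      and f: "square_integrable \<mu> f" for \<nu> \<rho> f
  proof -
    interpret \<rho>: prob_space \<rho> by fact
    show ?thesis
      using \<nu> \<rho> f \<mu> \<mu>.sigma_finite_measure_axioms \<rho>.sigma_finite_measure_axioms
        bessel_measure_sigma_finite[OF \<mu> \<nu>]
      by (intro L2_norm_sq_convolution) (auto simp: bessel_measures_def square_integrable_def)
  qed
  have const: "(\<integral>\<^sup>+ y. c \<partial>\<rho>) = c" if "prob_space \<rho>" for c and \<rho> :: "(real ^ 'n) measure"
    using prob_space.emeasure_space_1[OF that] by simp
  have bessel: "(\<nu> \<star> \<rho>) \<in> bessel_measures B \<mu>"
    if \<nu>: "\<nu> \<in> bessel_measures B \<mu>" and \<rho>: "borel_measure \<rho>" "prob_space \<rho>" for \<nu> \<rho>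
    unfolding bessel_measures_def
  proof (intro CollectI conjI allI impI)
    show "borel_measure (\<nu> \<star> \<rho>)"
      by (simp add: borel_measure_def)
    fix f assume f: "square_integrable \<mu> f"
    have "(\<integral>\<^sup>+ y. L2_norm_sq \<nu> (fourier_transform \<mu> (modulate y f)) \<partial>\<rho>) \<le>
        (\<integral>\<^sup>+ y. ennreal B * L2_norm_sq \<mu> (modulate y f) \<partial>\<rho>)"
      using \<nu> square_integrable_modulate[OF \<mu>(1) f]
      by (intro nn_integral_mono) (auto simp: bessel_measures_def simp del: L2_norm_sq_modulate)
    then show "L2_norm_sq (\<nu> \<star> \<rho>) (fourier_transform \<mu> f) \<le> ennreal B * L2_norm_sq \<mu> f"
      unfolding average[OF \<nu> \<rho> f] by (simp only: L2_norm_sq_modulate const[OF \<rho>(2)])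
  qed
  then show "closed_under_prob_convolution (bessel_measures B \<mu>)"
    by (simp add: closed_under_prob_convolution_def)
  have lower: "ennreal A * L2_norm_sq \<mu> f \<le> L2_norm_sq (\<nu> \<star> \<rho>) (fourier_transform \<mu> f)"
    if \<nu>: "\<nu> \<in> frame_measures A B \<mu>" and \<rho>: "borel_measure \<rho>" "prob_space \<rho>"
      and f: "square_integrable \<mu> f" for \<nu> \<rho> f
  proof -
    have "\<nu> \<in> bessel_measures B \<mu>"
      using \<nu> by (simp add: frame_measures_iff_lower_bound)
    note average = average[OF this \<rho> f]
    have "(\<integral>\<^sup>+ y. ennreal A * L2_norm_sq \<mu> (modulate y f) \<partial>\<rho>) \<le>
        (\<integral>\<^sup>+ y. L2_norm_sq \<nu> (fourier_transform \<mu> (modulate y f)) \<partial>\<rho>)"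
      using \<nu> square_integrable_modulate[OF \<mu>(1) f]
      by (intro nn_integral_mono) (auto simp: frame_measures_def simp del: L2_norm_sq_modulate)
    then show ?thesis
      unfolding average by (simp only: L2_norm_sq_modulate const[OF \<rho>(2)])
  qed
  show "closed_under_prob_convolution (frame_measures A B \<mu>)"
    using bessel lower
    by (simp add: closed_under_prob_convolution_def frame_measures_iff_lower_bound)
qed

theorem proposition2p3:
  fixes \<mu> :: "(real ^ 'n) measure" and A B :: real
  assumes "borel_measure \<mu>" and "prob_space \<mu>"
    and "A > 0" and "B > 0"
  shows "convex_measures (bessel_measures B \<mu>) \<and>
    closed_under_prob_convolution (bessel_measures B \<mu>) \<and>
    convex_measures (frame_measures A B \<mu>) \<and>
    closed_under_prob_convolution (frame_measures A B \<mu>)"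
  using assms by (intro conjI convex_bessel_measures convex_frame_measures
      bessel_measures_closed_under_prob_convolution frame_measures_closed_under_prob_convolution)

end
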